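(* Let $0<L\le U$ and $\delta\in(0,1)$, and consider ROS-$(\delta,\Delta)$ with $\Delta=k-1$. For every integer $k\ge1$ there exists a pricing-function design $\boldsymbol\phi^{(k)}=\{\phi_i\}_{i\in[k]}$ such that cPPM-$\boldsymbol\phi^{(k)}$ (with one unit reserved at each of the $k$ price levels) achieves a $\mathsf{CVaR}_\delta\text{-CR}$ of $\alpha^{\mathsf{DP}}_\delta=\alpha^{\mathsf{DP}}_\delta(k)$, where $\alpha^{\mathsf{DP}}_\delta\ge1$ is the unique value satisfying $$\alpha^{\mathsf{DP}}_\delta=\frac{kU\delta}{\sum_{i=1}^k\int_0^\delta\phi_i(\eta)\,d\eta}.$$ Moreover, with this design the $\mathsf{CVaR}_\delta\text{-CR}$ of cPPM-$\boldsymbol\phi^{(k)}$ is asymptotically optimal as $k\to\infty$: for any $\delta\in(0,1)$, in the limit $k\to\infty$ it attains the smallest possible $\mathsf{CVaR}_\delta\text{-CR}$ among all online algorithms, i.e. $$\lim_{k\to\infty}\Big(\mathsf{CVaR}_\delta\text{-CR}(\text{cPPM-}\boldsymbol\phi^{(k)})-\inf_{\mathrm{ALG}}\mathsf{CVaR}_\delta\text{-CR}(\mathrm{ALG})\Big)=0,$$ where for each $k$ the infimum is over all online algorithms for the problem with $k$ units.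
   Context: Problem ROS-$(\delta,\Delta)$ (with $\delta\in(0,1]$, $\Delta\in\{0,\dots,k-1\}$): a seller has $k$ identical units. Buyers $t=1,\dots,T$ arrive one by one; buyer $t$ has a private value $v_t\in[L,U]$, where $0<L\le U$ are known. When buyer $t$ arrives the seller posts a price $p_t$; if units remain, the buyer accepts and buys one unit ($x_t=1$) if $v_t\ge p_t$ and otherwise leaves ($x_t=0$). At most $k$ units can be sold. An online algorithm chooses each $p_t$ (possibly at random, and possibly depending on the past) without knowing the future values $v_{t'}$, $t'>t$, or $T$. The cap requires $\sum_{t=1}^{T-1}\mathbf 1\{p_t\ne p_{t+1}\}\le\Delta$; in the case $\Delta=k-1$ the cap is regarded as fully relaxed. For an instance $I=(v_1,\dots,v_T)$, $\mathrm{ALG}(I,P)=\sum_t v_tx_t$ is the (random) social welfare, and $\mathrm{OPT}(I)$ is the sum of the $k$ highest values in $I$ (all values if $T<k$). $\mathsf{CVaR}_\delta[X]=\sup_{\tau\in\mathbb R}\{\tau-\frac1\delta\mathbb E[(\tau-X)_+]\}$, where $(x)_+=\max\{x,0\}$. $\mathsf{CVaR}_\delta\text{-CR}(\mathrm{ALG})=\sup_I \mathrm{OPT}(I)/\mathsf{CVaR}_\delta[\mathrm{ALG}(I,P)]$, the supremum being over all instances (any $T\ge1$, any values in $[L,U]$). A pricing-function design for $\Delta=k-1$ is a family of nondecreasing functions $\phi_1,\dots,\phi_k$ on $[0,1]$ with $\phi_i(1)\le\phi_{i+1}(0)$ for $i=1,\dots,k-1$. Mechanism cPPM-$\boldsymbol\phi$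 with one unit reserved per level: draw a single seed $R$ uniformly from $[0,1]$; while $y<k$ units have been sold, post the price $\phi_{y+1}(R)$ to the arriving buyer, who buys one unit if and only if the buyer's value is at least this price. After $k$ sales nothing more is sold. Notation: $[n]=\{1,\dots,n\}$. *)

theory Defs
  imports "HOL-Probability.Probability"
begin

text \<open>The past of a run: the earlier buyers in order of arrival, each with its value and with
  whether a unit was sold to it. The posted prices are not recorded, because they are determined
  by the past and the seller's random seed.\<close>

type_synonym history = "(real \<times> bool) list"

definition units_sold :: "history \<Rightarrow> nat" where
  "units_sold h = length (filter snd h)"

text \<open>For a fixed seed, a pricing rule \<open>p\<close> maps the past to the price for the next buyer.
  It sees neither the current value, nor later values, nor the number of buyers. After \<open>k\<close> sales
  a price is still computed but has no effect.\<close>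

primrec run :: "nat \<Rightarrow> (history \<Rightarrow> real) \<Rightarrow> history \<Rightarrow> real list \<Rightarrow> history" where
  "run k p h [] = h"
| "run k p h (v # vs) = run k p (h @ [(v, units_sold h < k \<and> p h \<le> v)]) vs"

definition welfare :: "nat \<Rightarrow> (history \<Rightarrow> real) \<Rightarrow> real list \<Rightarrow> real" where
  "welfare k p vs = (\<Sum>(v, x)\<leftarrow>run k p [] vs. if x then v else 0)"

definition opt :: "nat \<Rightarrow> real list \<Rightarrow> real" where
  "opt k vs = sum_list (take k (rev (sort vs)))"

definition instances :: "real \<Rightarrow> real \<Rightarrow> real list set" where
  "instances L U = {vs. vs \<noteq> [] \<and> set vs \<subseteq> {L..U}}"

definition CVaR :: "real \<Rightarrow> 'w measure \<Rightarrow> ('w \<Rightarrow> real) \<Rightarrow> ereal" where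
  "CVaR \<delta> M X = (SUP \<tau>::real. ereal (\<tau> - 1 / \<delta> * (\<integral>\<omega>. max (\<tau> - X \<omega>) 0 \<partial>M)))"

text \<open>A randomized pricing rule is a family \<open>p \<omega>\<close> of pricing rules with the seed \<open>\<omega>\<close> drawn
  from \<open>M\<close>. The ratio is taken in \<^typ>\<open>ereal\<close>, so it is infinite for an instance on which the
  CVaR of the welfare is 0.\<close>

definition CVaR_CR ::
  "real \<Rightarrow> real \<Rightarrow> real \<Rightarrow> nat \<Rightarrow> 'w measure \<Rightarrow> ('w \<Rightarrow> history \<Rightarrow> real) \<Rightarrow> ereal" where
  "CVaR_CR \<delta> L U k M p =
     (SUP vs\<in>instances L U. ereal (opt k vs) / CVaR \<delta> M (\<lambda>\<omega>. welfare k (p \<omega>) vs))"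

text \<open>All randomized online algorithms, with no cap on the number of price changes. The seed is
  a sequence of reals with an arbitrary joint law, so every round can use fresh randomness; by
  quantile transforms this covers prices drawn round by round from arbitrary conditional
  distributions given the past.\<close>

definition online_algs ::
  "((nat \<Rightarrow> real) measure \<times> ((nat \<Rightarrow> real) \<Rightarrow> history \<Rightarrow> real)) set" where
  "online_algs = {(M, p). prob_space M \<and> (\<forall>h. (\<lambda>\<omega>. p \<omega> h) \<in> borel_measurable M)}"

definition optimal_CVaR_CR :: "real \<Rightarrow> real \<Rightarrow> real \<Rightarrow> nat \<Rightarrow> ereal" where
  "optimal_CVaR_CR \<delta> L U k = (INF (M, p)\<in>online_algs. CVaR_CR \<delta> L U k M p)"

definition pricing_design :: "nat \<Rightarrow> (nat \<Rightarrow> real \<Rightarrow> real) \<Rightarrow> bool" where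
  "pricing_design k \<phi> \<longleftrightarrow>
     (\<forall>i\<in>{1..k}. mono_on {0..1} (\<phi> i)) \<and> (\<forall>i\<in>{1..<k}. \<phi> i 1 \<le> \<phi> (i + 1) 0)"

definition cPPM :: "(nat \<Rightarrow> real \<Rightarrow> real) \<Rightarrow> real \<Rightarrow> history \<Rightarrow> real" where
  "cPPM \<phi> r h = \<phi> (units_sold h + 1) r"

text \<open>The seed is uniform on \<open>[0,1]\<close>. The measure is restricted to that interval because the
  functions of a design are unconstrained, possibly non-measurable, outside it.\<close>

definition cPPM_CVaR_CR ::
  "real \<Rightarrow> real \<Rightarrow> real \<Rightarrow> nat \<Rightarrow> (nat \<Rightarrow> real \<Rightarrow> real) \<Rightarrow> ereal" where
  "cPPM_CVaR_CR \<delta> L U k \<phi> = CVaR_CR \<delta> L U k (restrict_space lborel {0..1}) (cPPM \<phi>)"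

end

theory Submission
  imports Defs "HOL-Real_Asymp.Real_Asymp"
begin

text \<open>A design with constant price functions is enough: with \<open>k\<close> units, the price after \<open>s\<close>
  sales is the larger of \<open>L\<close> and \<open>\<alpha>/k\<close> times the sum of the earlier prices, and \<open>\<alpha>\<close> is chosen such
  that the price after \<open>k\<close> sales would be \<open>U\<close>. The welfare is then deterministic, so it equals its
  CVaR, and the ratio is exactly \<open>\<alpha>\<close>. The growth of the price sums gives \<open>\<alpha> \<le> 1 + ln (U/L) + O(1/k)\<close>.
  Conversely the CVaR is at most the expectation, and on batches of \<open>k\<close> equal buyers with
  geometrically increasing values no online algorithm has an expected ratio below
  \<open>1 + ln (U/L)\<close>.\<close>

section \<open>Runs, welfare and the offline optimum\<close>

text \<open>\<open>welfare\<close> starts from the empty past; a version on histories lets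
  inductions over the buyers start from any past.\<close>

definition hist_welfare :: "history \<Rightarrow> real" where
  "hist_welfare h = (\<Sum>(v, x)\<leftarrow>h. if x then v else 0)"

lemma hist_welfare_simps [simp]:
  "hist_welfare [] = 0"
  "hist_welfare (h @ [(v, x)]) = hist_welfare h + (if x then v else 0)"
  by (simp_all add: hist_welfare_def)

lemma units_sold_simps [simp]:
  "units_sold [] = 0"
  "units_sold (h @ [(v, x)]) = units_sold h + (if x then 1 else 0)"
  by (simp_all add: units_sold_def)

lemma welfare_eq: "welfare k p vs = hist_welfare (run k p [] vs)"
  by (simp add: welfare_def hist_welfare_def)

lemma run_append: "run k p h (xs @ ys) = run k p (run k p h xs) ys"
  by (induction xs arbitrary: h) auto

lemma units_sold_run_le:
  "units_sold h \<le> k \<Longrightarrow> units_sold (run k p h vs) \<le> k"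
  by (induction vs arbitrary: h) auto

lemma hist_welfare_run_nonneg:
  "0 \<le> hist_welfare h \<Longrightarrow> set vs \<subseteq> {0..} \<Longrightarrow> 0 \<le> hist_welfare (run k p h vs)"
  by (induction vs arbitrary: h) auto

lemma hist_welfare_run_le:
  "set vs \<subseteq> {0..} \<Longrightarrow> hist_welfare (run k p h vs) \<le> hist_welfare h + sum_list vs"
proof (induction vs arbitrary: h)
  case (Cons v vs)
  from Cons.IH[of "h @ [(v, units_sold h < k \<and> p h \<le> v)]"] Cons.prems
  show ?case by (auto split: if_splits)
qed auto

lemma hist_welfare_run_replicate:
  "hist_welfare (run k p h (replicate n v)) - hist_welfare h
    = v * (real (units_sold (run k p h (replicate n v))) - real (units_sold h))"
proof (induction n arbitrary: h)
  case (Suc n)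
  from Suc.IH[of "h @ [(v, units_sold h < k \<and> p h \<le> v)]"]
  show ?case by (auto simp: algebra_simps split: if_splits)
qed auto

text \<open>For a fixed instance the run meets only finitely many histories, so no measurability in
  the history is needed.\<close>
lemma measurable_run:
  fixes f :: "history \<Rightarrow> real"
  assumes "\<And>h. (\<lambda>\<omega>. p \<omega> h) \<in> borel_measurable M"
  shows "(\<lambda>\<omega>. f (run k (p \<omega>) h vs)) \<in> borel_measurable M"
proof (induction vs arbitrary: h)
  case (Cons v vs)
  note [measurable] = assms Cons.IH
  have "(\<lambda>\<omega>. f (run k (p \<omega>) h (v # vs))) =
    (\<lambda>\<omega>. if units_sold h < k \<and> p \<omega> h \<le> v then f (run k (p \<omega>) (h @ [(v, True)]) vs)
      else f (run k (p \<omega>) (h @ [(v, False)]) vs))"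
    by (auto simp: fun_eq_iff)
  also have "\<dots> \<in> borel_measurable M" by measurable
  finally show ?case .
qed simp

lemma opt_append_replicate:
  assumes "sorted (vs @ replicate k v)"
  shows "opt k (vs @ replicate k v) = real k * v"
  using assms by (simp add: opt_def sorted_sort_id sum_list_replicate)

lemma sum_list_take_le:
  fixes xs :: "real list"
  assumes "set xs \<subseteq> {0..}"
  shows "sum_list (take k xs) \<le> sum_list xs"
proof -
  have "0 \<le> sum_list (drop k xs)"
    using assms set_drop_subset[of k xs] by (intro sum_list_nonneg) auto
  moreover have "sum_list xs = sum_list (take k xs) + sum_list (drop k xs)"
    by (metis append_take_drop_id sum_list_append)
  ultimately show ?thesis by simp
qed

lemma sum_list_rev_sort: "sum_list (map f (rev (sort vs))) = (sum_list (map f vs) :: real)"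
  by (simp flip: sum_mset_sum_list)

lemma opt_le_sum_list: "set vs \<subseteq> {0..} \<Longrightarrow> opt k vs \<le> sum_list vs"
  using sum_list_take_le[of "rev (sort vs)" k] sum_list_rev_sort[of "\<lambda>x. x" vs]
  by (simp add: opt_def)

text \<open>Weak duality with \<open>q\<close> as the price of a unit: each of the at most
  \<open>k\<close> chosen values is at most \<open>q\<close> plus its excess over \<open>q\<close>,
  and the excesses of the other buyers are nonnegative.\<close>

lemma opt_le_threshold:
  assumes "0 \<le> q"
  shows "opt k vs \<le> real k * q + (\<Sum>v\<leftarrow>vs. max (v - q) 0)"
proof -
  let ?s = "rev (sort vs)"
  have "opt k vs \<le> (\<Sum>v\<leftarrow>take k ?s. q + max (v - q) 0)"
    unfolding opt_def
    using sum_list_mono[of "take k ?s" "\<lambda>v. v" "\<lambda>v. q + max (v - q) 0"] by simp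
  also have "\<dots> = real (length (take k ?s)) * q + sum_list (take k (map (\<lambda>v. max (v - q) 0) ?s))"
    by (simp add: sum_list_addf sum_list_triv take_map)
  also have "\<dots> \<le> real k * q + sum_list (map (\<lambda>v. max (v - q) 0) ?s)"
    using assms by (intro add_mono mult_right_mono sum_list_take_le) auto
  finally show ?thesis by (simp only: sum_list_rev_sort)
qed

section \<open>Conditional value at risk\<close>

lemma CVaR_const:
  assumes "prob_space M" "0 < \<delta>" "\<delta> \<le> 1"
  shows "CVaR \<delta> M (\<lambda>_. c) = ereal c"
proof -
  interpret prob_space M by fact
  have "\<tau> - 1 / \<delta> * max (\<tau> - c) 0 \<le> c" for \<tau>
  proof -
    have "\<tau> - c \<le> 1 * max (\<tau> - c) 0" by simp
    also have "\<dots> \<le> 1 / \<delta> * max (\<tau> - c) 0"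
      using assms by (intro mult_right_mono) auto
    finally show ?thesis by (simp only: diff_le_eq le_diff_eq add.commute)
  qed
  then show ?thesis
    unfolding CVaR_def
    by (intro antisym SUP_least SUP_upper2[of c]) (auto simp: prob_space)
qed

text \<open>Since \<open>1 / \<delta>\<close> is at least 1, the objective is at most tau -
  E[(tau - X)_+], which is at most tau - E[tau - X] = E[X].\<close>

lemma CVaR_le_expectation:
  assumes "prob_space M" "0 < \<delta>" "\<delta> \<le> 1" and X [simp]: "integrable M X"
  shows "CVaR \<delta> M X \<le> ereal (\<integral>\<omega>. X \<omega> \<partial>M)"
proof -
  interpret prob_space M by fact
  have "\<tau> - 1 / \<delta> * (\<integral>\<omega>. max (\<tau> - X \<omega>) 0 \<partial>M) \<le> (\<integral>\<omega>. X \<omega> \<partial>M)" for \<tau>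
  proof -
    let ?e = "\<integral>\<omega>. max (\<tau> - X \<omega>) 0 \<partial>M"
    have "(\<integral>\<omega>. \<tau> - X \<omega> \<partial>M) \<le> ?e" by (intro integral_mono) auto
    then have "\<tau> - (\<integral>\<omega>. X \<omega> \<partial>M) \<le> ?e" by (simp add: prob_space)
    moreover have "1 * ?e \<le> 1 / \<delta> * ?e"
      using assms by (intro mult_right_mono integral_nonneg_AE) auto
    ultimately show ?thesis by linarith
  qed
  then show ?thesis unfolding CVaR_def by (intro SUP_least) simp
qed

lemma CVaR_nonneg:
  assumes "\<And>\<omega>. 0 \<le> X \<omega>"
  shows "0 \<le> CVaR \<delta> M X"
  using assms unfolding CVaR_def by (intro SUP_upper2[of 0]) (auto simp: max_def)

section \<open>The lower bound for all online algorithms\<close>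

text \<open>Summation by parts: \<open>s n\<close> is the sum of the increments of \<open>w\<close>,
  each divided by its \<open>v j\<close>. For nondecreasing \<open>v\<close> all coefficients of the
  \<open>w i\<close> are nonnegative, so lower bounds on the \<open>w i\<close> carry over to
  \<open>s n\<close>.\<close>

lemma abel_sum:
  fixes s w v :: "nat \<Rightarrow> real"
  assumes "w 0 = v 0 * s 0" "\<And>j. w (Suc j) - w j = v (Suc j) * (s (Suc j) - s j)" "\<And>j. 0 < v j"
  shows "s n = w n / v n + (\<Sum>i<n. w i * (1 / v i - 1 / v (Suc i)))"
proof (induction n)
  case 0
  show ?case using assms(1) assms(3)[of 0] by (simp add: field_simps)
next
  case (Suc n)
  have "s (Suc n) - s n = (w (Suc n) - w n) / v (Suc n)"
    using assms(3)[of "Suc n"] assms(2)[of n] by (simp add: field_simps)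
  with Suc show ?case by (simp add: algebra_simps diff_divide_distrib)
qed

text \<open>The hard instances. Each is a prefix of the next, so an online algorithm acts alike on
  the common part without knowing which one it faces.\<close>

definition batches :: "nat \<Rightarrow> (nat \<Rightarrow> real) \<Rightarrow> nat \<Rightarrow> real list" where
  "batches k v j = concat (map (\<lambda>i. replicate k (v i)) [0..<j])"

lemma batches_Suc: "batches k v (Suc j) = batches k v j @ replicate k (v j)"
  by (simp add: batches_def)

lemma set_batches_subset: "set (batches k v j) \<subseteq> v ` {..<j}"
  by (auto simp: batches_def)

lemma sorted_batches: "mono v \<Longrightarrow> sorted (batches k v j)"
proof (induction j)
  case (Suc j)
  have "x \<le> v j" if "x \<in> set (batches k v j)" for x
    using that set_batches_subset[of k v j] monoD[OF Suc.prems] by (auto dest!: subsetD)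
  with Suc show ?case by (auto simp: batches_Suc sorted_append)
qed (simp add: batches_def)

text \<open>When batch \<open>j\<close> is the last, the optimum is \<open>k * v j\<close>, so a
  ratio \<open>\<beta>\<close> forces an expected welfare of at least
  \<open>k * v j / \<beta>\<close>. By \<open>abel_sum\<close> these bounds force expected sales of
  at least \<open>k / \<beta>\<close> times the claimed bound, but only \<open>k\<close> units
  exist.\<close>

lemma CVaR_CR_ge_sum:
  assumes M: "prob_space M" and p: "\<And>h. (\<lambda>\<omega>. p \<omega> h) \<in> borel_measurable M"
    and "0 < \<delta>" "\<delta> \<le> 1" "1 \<le> k" "0 < L"
    and v: "mono v" "\<And>j. j \<le> n \<Longrightarrow> v j \<in> {L..U}" "\<And>j. 0 < v j"
  shows "ereal (1 + (\<Sum>i<n. 1 - v i / v (Suc i))) \<le> CVaR_CR \<delta> L U k M p"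
\<comment> \<open>It is enough to treat real upper bounds \<open>\<beta>\<close> of the ratio; an
  infinite ratio has none.\<close>
proof (rule ereal_le_real)
  fix \<beta>
  assume \<beta>: "CVaR_CR \<delta> L U k M p \<le> ereal \<beta>"
  interpret prob_space M by fact
  define w where "w j \<omega> = welfare k (p \<omega>) (batches k v (Suc j))" for j \<omega>
  define s where "s j \<omega> = real (units_sold (run k (p \<omega>) [] (batches k v (Suc j))))" for j \<omega>
  have nonneg: "set (batches k v j) \<subseteq> {0..}" for j
    using v(3) by (auto simp: batches_def less_imp_le)
  have w_nonneg: "0 \<le> w j \<omega>" for j \<omega>
    unfolding w_def welfare_eq using nonneg by (intro hist_welfare_run_nonneg) auto
  have int_w [simp]: "integrable M (w j)" for j
  proof (rule integrable_const_bound)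
    show "AE \<omega> in M. norm (w j \<omega>) \<le> sum_list (batches k v (Suc j))"
      using w_nonneg hist_welfare_run_le[OF nonneg, of k _ "[]" "Suc j"]
      by (simp add: w_def welfare_eq)
    show "w j \<in> borel_measurable M"
      unfolding w_def welfare_eq using p by (rule measurable_run)
  qed
  have abel: "s n \<omega> = w n \<omega> / v n + (\<Sum>i<n. w i \<omega> * (1 / v i - 1 / v (Suc i)))" for \<omega>
  proof (rule abel_sum[where s = "\<lambda>j. s j \<omega>" and w = "\<lambda>j. w j \<omega>"])
    show "w 0 \<omega> = v 0 * s 0 \<omega>"
      using hist_welfare_run_replicate[of k "p \<omega>" "[]" k "v 0"]
      by (simp add: w_def s_def welfare_eq batches_def)
    show "w (Suc j) \<omega> - w j \<omega> = v (Suc j) * (s (Suc j) \<omega> - s j \<omega>)" for j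
      unfolding w_def s_def welfare_eq batches_Suc[of k v "Suc j"] run_append
      by (rule hist_welfare_run_replicate)
  qed (rule v(3))
  have cr: "0 < \<beta> \<and> real k * v j / \<beta> \<le> (\<integral>\<omega>. w j \<omega> \<partial>M)" if "j \<le> n" for j
  proof -
    have "v ` {..<Suc j} \<subseteq> {L..U}" using that v(2) by fastforce
    then have "set (batches k v (Suc j)) \<subseteq> {L..U}"
      using set_batches_subset[of k v "Suc j"] by blast
    moreover have "batches k v (Suc j) \<noteq> []" using \<open>1 \<le> k\<close> by (simp add: batches_Suc)
    ultimately have "batches k v (Suc j) \<in> instances L U" by (simp add: instances_def)
    then have "ereal (opt k (batches k v (Suc j))) / CVaR \<delta> M (w j) \<le> CVaR_CR \<delta> L U k M p"
      unfolding CVaR_CR_def w_def by (intro SUP_upper)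
    also note \<beta>
    also have "opt k (batches k v (Suc j)) = real k * v j"
      unfolding batches_Suc
      using sorted_batches[OF v(1), of k "Suc j"] by (intro opt_append_replicate) (simp add: batches_Suc)
    finally have le: "ereal (real k * v j) / CVaR \<delta> M (w j) \<le> ereal \<beta>" .
    have up: "CVaR \<delta> M (w j) \<le> ereal (\<integral>\<omega>. w j \<omega> \<partial>M)"
      using assms by (intro CVaR_le_expectation) auto
    have "0 \<le> CVaR \<delta> M (w j)" using w_nonneg by (intro CVaR_nonneg)
    with up obtain x where x: "CVaR \<delta> M (w j) = ereal x" "0 \<le> x"
      by (cases "CVaR \<delta> M (w j)") auto
    have pos: "0 < real k * v j" using \<open>1 \<le> k\<close> v(3)[of j] by simp
    \<comment> \<open>A CVaR of 0 would make the quotient infinite, against the real bound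
      \<open>\<beta>\<close>.\<close>
    have "ereal y / 0 = \<infinity>" if "0 < y" for y
      using that by (simp add: divide_ereal_def)
    from this[OF pos] have "x \<noteq> 0" using le x(1)
      by (metis ereal_infty_less_eq(1) PInfty_neq_ereal(1) zero_ereal_def)
    with x le have *: "0 < x" "real k * v j / x \<le> \<beta>" by auto
    with pos have "0 < \<beta>" by (meson divide_pos_pos less_le_trans)
    moreover have "real k * v j / \<beta> \<le> x" using * \<open>0 < \<beta>\<close> by (simp add: field_simps)
    moreover have "x \<le> (\<integral>\<omega>. w j \<omega> \<partial>M)" using up x(1) by simp
    ultimately show ?thesis by linarith
  qed
  then have \<beta>_pos: "0 < \<beta>" by blast
  have v_le: "v i \<le> v (Suc i)" for i using v(1) by (simp add: monoD)
  have k_le: "s n \<omega> \<le> real k" for \<omega>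
    unfolding s_def of_nat_le_iff by (rule units_sold_run_le) simp
  \<comment> \<open>The right-hand side is the Abel sum with each expected welfare replaced by its
    lower bound.\<close>
  have "real k / \<beta> * (1 + (\<Sum>i<n. 1 - v i / v (Suc i)))
      = real k * v n / \<beta> / v n + (\<Sum>i<n. real k * v i / \<beta> * (1 / v i - 1 / v (Suc i)))"
  proof -
    have "real k * v i / \<beta> * (1 / v i - 1 / v (Suc i)) = real k / \<beta> * (1 - v i / v (Suc i))" for i
      using v(3)[of i] v(3)[of "Suc i"] \<beta>_pos by (simp add: field_simps)
    moreover have "real k * v n / \<beta> / v n = real k / \<beta>" using v(3)[of n] by simp
    ultimately show ?thesis by (simp only: sum_distrib_left distrib_left mult_1_right)
  qed
  also have "\<dots> \<le> (\<integral>\<omega>. w n \<omega> \<partial>M) / v n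
      + (\<Sum>i<n. (\<integral>\<omega>. w i \<omega> \<partial>M) * (1 / v i - 1 / v (Suc i)))"
    using cr v(3) v_le
    by (intro add_mono divide_right_mono sum_mono mult_right_mono) (auto simp: less_imp_le frac_le)
  also have "\<dots> = (\<integral>\<omega>. w n \<omega> / v n + (\<Sum>i<n. w i \<omega> * (1 / v i - 1 / v (Suc i))) \<partial>M)"
    by simp
  also have "\<dots> \<le> (\<integral>\<omega>. real k \<partial>M)"
    using k_le unfolding abel by (intro integral_mono) auto
  also have "\<dots> = real k" by (simp add: prob_space)
  finally have "real k * (1 + (\<Sum>i<n. 1 - v i / v (Suc i))) \<le> real k * \<beta>"
    using \<beta>_pos by (simp add: field_simps)
  then show "ereal (1 + (\<Sum>i<n. 1 - v i / v (Suc i))) \<le> ereal \<beta>"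
    using \<open>1 \<le> k\<close> by simp
qed

text \<open>Going from \<open>L\<close> to \<open>U\<close> in \<open>n\<close> geometric steps
  makes every quotient \<open>v i / v (Suc i)\<close> equal to exp(-x/n) with x = ln (U/L), and n (1
  - exp(-x/n)) tends to x.\<close>

lemma CVaR_CR_ge_ln:
  assumes "prob_space M" "\<And>h. (\<lambda>\<omega>. p \<omega> h) \<in> borel_measurable M"
    and "0 < \<delta>" "\<delta> \<le> 1" "1 \<le> k" "0 < L" "L \<le> U"
  shows "ereal (1 + ln (U / L)) \<le> CVaR_CR \<delta> L U k M p"
proof (rule tendsto_upperbound)
  define x where "x = ln (U / L)"
  have x: "0 \<le> x" "exp x = U / L" using assms by (simp_all add: x_def)
  show "(\<lambda>n. ereal (1 + real n * (1 - exp (- x / real n)))) \<longlonglongrightarrow> ereal (1 + ln (U / L))"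
    unfolding x_def[symmetric] by (intro tendsto_ereal) real_asymp
  show "\<forall>\<^sub>F n in sequentially. ereal (1 + real n * (1 - exp (- x / real n))) \<le> CVaR_CR \<delta> L U k M p"
    using eventually_gt_at_top[of 0]
  proof eventually_elim
    case (elim n)
    \<comment> \<open>\<open>v 0 = L\<close> and \<open>v n = U\<close>; the formula is kept for all
      \<open>j\<close> so that monotonicity and positivity hold everywhere.\<close>
    define v where "v j = L * exp (x * real j / real n)" for j
    have "mono v"
      unfolding v_def using \<open>0 < L\<close> x(1) by (intro monoI) (auto intro!: divide_right_mono mult_left_mono)
    moreover have "v j \<in> {L..U}" if "j \<le> n" for j
    proof -
      have "v 0 \<le> v j" "v j \<le> v n" using \<open>mono v\<close> that by (auto intro: monoD)
      then show ?thesis using elim x assms by (simp add: v_def)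
    qed
    moreover have "0 < v j" for j using assms by (simp add: v_def)
    ultimately have "ereal (1 + (\<Sum>i<n. 1 - v i / v (Suc i))) \<le> CVaR_CR \<delta> L U k M p"
      using assms by (intro CVaR_CR_ge_sum) auto
    moreover have "v i / v (Suc i) = exp (- x / real n)" for i
      using assms elim by (simp add: v_def field_simps flip: exp_add exp_minus exp_diff)
    ultimately show ?case by simp
  qed
qed simp

lemma optimal_CVaR_CR_ge_ln:
  assumes "0 < \<delta>" "\<delta> \<le> 1" "1 \<le> k" "0 < L" "L \<le> U"
  shows "ereal (1 + ln (U / L)) \<le> optimal_CVaR_CR \<delta> L U k"
  unfolding optimal_CVaR_CR_def online_algs_def
  using assms by (intro INF_greatest) (auto intro!: CVaR_CR_ge_ln)

section \<open>The price sequence\<close>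

text \<open>A price depends on the earlier prices only through their sum, so the recursion carries
  the sum, and \<open>price\<close> names its increment.\<close>

primrec price_sum :: "real \<Rightarrow> real \<Rightarrow> nat \<Rightarrow> real" where
  "price_sum L c 0 = 0"
| "price_sum L c (Suc n) = price_sum L c n + max L (c * price_sum L c n)"

definition price :: "real \<Rightarrow> real \<Rightarrow> nat \<Rightarrow> real" where
  "price L c n = max L (c * price_sum L c n)"

lemma price_sum_Suc: "price_sum L c (Suc n) = price_sum L c n + price L c n"
  by (simp add: price_def)

declare price_sum.simps(2) [simp del]
declare price_sum_Suc [simp]

lemma price_sum_eq_sum: "price_sum L c n = (\<Sum>i<n. price L c i)"
  by (induction n) auto

lemma price_ge: "L \<le> price L c n"
  by (simp add: price_def)

lemma price_sum_ge: "real n * L \<le> price_sum L c n"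
  unfolding price_sum_eq_sum using sum_mono[of "{..<n}" "\<lambda>_. L" "price L c"] price_ge by simp

lemma price_mono:
  assumes "0 \<le> L" "0 \<le> c"
  shows "mono (price L c)"
proof (rule monoI)
  fix m n :: nat
  assume "m \<le> n"
  then have "price_sum L c m \<le> price_sum L c n"
  proof (induction rule: dec_induct)
    case (step j)
    then show ?case using assms price_ge[of L c j] by simp
  qed simp
  then show "price L c m \<le> price L c n"
    unfolding price_def using assms by (intro max.mono mult_left_mono) auto
qed

text \<open>The first \<open>m\<close> prices are at least \<open>L\<close> each; every further
  price is at least \<open>c\<close> times the current sum and so multiplies it by at least
  \<open>1 + c\<close>.\<close>

lemma price_sum_growth:
  assumes "0 \<le> L" "0 \<le> c"
  shows "real m * L * (1 + c) ^ n \<le> price_sum L c (m + n)"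
proof (induction n)
  case (Suc n)
  have "real m * L * (1 + c) ^ Suc n \<le> price_sum L c (m + n) * (1 + c)"
    using mult_right_mono[OF Suc.IH, of "1 + c"] assms by (simp add: mult_ac)
  also have "\<dots> \<le> price_sum L c (m + Suc n)" by (simp add: price_def algebra_simps)
  finally show ?case .
qed (simp add: price_sum_ge)

lemma continuous_price_sum:
  "continuous_on A g \<Longrightarrow> continuous_on A (\<lambda>x. price_sum L (g x) n)"
  by (induction n) (auto simp: price_def intro!: continuous_intros)

text \<open>Intermediate value theorem on \<open>{1..U / L}\<close>: at 1 the first \<open>k\<close>
  prices all equal \<open>L\<close>, so the expression is \<open>L\<close>; at \<open>U / L\<close>
  the bound \<open>k * L\<close> on the price sum makes it at least \<open>U\<close>.\<close>

lemma exists_ratio: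
  assumes "1 \<le> k" "0 < L" "L \<le> U"
  shows "\<exists>\<alpha>\<ge>1. \<alpha> \<le> U / L \<and> \<alpha> / real k * price_sum L (\<alpha> / real k) k = U"
proof -
  let ?f = "\<lambda>\<alpha>. \<alpha> / real k * price_sum L (\<alpha> / real k) k"
  have "price_sum L (1 / real k) n = real n * L" if "n \<le> k" for n
    using that
  proof (induction n)
    case (Suc n)
    then have "real n * L \<le> real k * L" using assms by (intro mult_right_mono) auto
    then have "1 / real k * (real n * L) \<le> L" using assms by (simp add: field_simps)
    then show ?case using Suc by (simp add: price_def max_absorb1 algebra_simps)
  qed simp
  then have lo: "?f 1 \<le> U" using assms by simp
  have "U = U / L / real k * (real k * L)" using assms by simp
  also have "\<dots> \<le> ?f (U / L)"
    using assms by (intro mult_left_mono price_sum_ge) auto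
  finally have hi: "U \<le> ?f (U / L)" .
  have "continuous_on {1..U / L} ?f"
    using assms by (intro continuous_intros continuous_price_sum) auto
  from IVT'[OF lo hi _ this] assms show ?thesis by auto
qed

text \<open>With \<open>c = \<alpha> / k\<close>, exponential growth of the sum after about
  \<open>1 / c\<close> prices gives \<open>(1 + c) ^ (k - m) \<le> U / L\<close>. In logarithms,
  \<open>(k - m) * c\<close>, which is about \<open>\<alpha> - 1\<close>, is at most
  \<open>(1 + c) * ln (U / L)\<close>. The bound \<open>\<alpha> \<le> U / L\<close> makes the error
  of order 1/k.\<close>

lemma ratio_upper_bound:
  assumes "1 \<le> k" "0 < L" "L \<le> U" "1 \<le> \<alpha>" "\<alpha> \<le> U / L"
    and U: "\<alpha> / real k * price_sum L (\<alpha> / real k) k = U"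
  shows "\<alpha> \<le> 1 + ln (U / L) + U / L * (1 + ln (U / L)) / real k"
proof -
  \<comment> \<open>The least \<open>m\<close> with \<open>c * m \<ge> 1\<close>: after
    \<open>m\<close> prices, \<open>c\<close> times the sum has reached \<open>L\<close>.\<close>
  define m where "m = nat \<lceil>real k / \<alpha>\<rceil>"
  define c where "c = \<alpha> / real k"
  have c: "0 < c" using assms by (simp add: c_def)
  have m: "real k / \<alpha> \<le> real m" "real m \<le> real k / \<alpha> + 1" using assms by (auto simp: m_def)
  have "real k / \<alpha> \<le> real k" using assms by (simp add: field_simps)
  then have "m \<le> k" unfolding m_def by linarith
  have "1 * (L * (1 + c) ^ (k - m)) \<le> c * real m * (L * (1 + c) ^ (k - m))"
  proof (rule mult_right_mono)
    show "1 \<le> c * real m" using m(1) assms by (simp add: c_def field_simps)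
    show "0 \<le> L * (1 + c) ^ (k - m)" using assms c by simp
  qed
  also have "\<dots> \<le> c * price_sum L c k"
    using price_sum_growth[of L c m "k - m"] assms c \<open>m \<le> k\<close> by simp
  also have "\<dots> = U" using U by (simp add: c_def)
  finally have "(1 + c) ^ (k - m) \<le> U / L" using assms by (simp add: field_simps)
  then have "ln ((1 + c) ^ (k - m)) \<le> ln (U / L)" using assms c by (subst ln_le_cancel_iff) auto
  then have ln_le: "(real k - real m) * ln (1 + c) \<le> ln (U / L)"
    using c \<open>m \<le> k\<close> by (simp add: ln_realpow of_nat_diff)
  \<comment> \<open>\<open>ln x \<le> x - 1\<close> at \<open>x = 1 / (1 + c)\<close> bounds
    \<open>ln (1 + c)\<close> from below.\<close>
  have "ln (1 / (1 + c)) \<le> 1 / (1 + c) - 1" using c by (intro ln_le_minus_one) auto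
  then have ln_ge: "c / (1 + c) \<le> ln (1 + c)" using c by (simp add: ln_div field_simps)
  have "(real k - real m) * (c / (1 + c)) \<le> ln (U / L)"
    using mult_left_mono[OF ln_ge, of "real k - real m"] \<open>m \<le> k\<close> ln_le by simp
  then have "(real k - real m) * c \<le> ln (U / L) * (1 + c)" using c by (simp add: field_simps)
  \<comment> \<open>The \<open>+ 1\<close> absorbs the rounding in \<open>m\<close>, at the cost of
    one \<open>c\<close>.\<close>
  moreover have "(real k - (real k / \<alpha> + 1)) * c \<le> (real k - real m) * c"
    using m c by (intro mult_right_mono) auto
  moreover have "(real k - (real k / \<alpha> + 1)) * c = \<alpha> - 1 - c"
    using assms by (simp add: c_def field_simps)
  ultimately have "\<alpha> \<le> 1 + ln (U / L) + c * (1 + ln (U / L))" by (simp add: algebra_simps)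
  also have "c * (1 + ln (U / L)) \<le> U / L / real k * (1 + ln (U / L))"
    unfolding c_def using assms by (intro mult_right_mono divide_right_mono add_nonneg_nonneg) auto
  finally show ?thesis by simp
qed

section \<open>Competitive ratio of the deterministic prices\<close>

text \<open>A sale at price \<open>P i \<le> q\<close> yields \<open>P i\<close> plus a surplus of
  at least the excess over \<open>q\<close>. A buyer without a unit has no excess: the value is
  below the current price, or all units are gone and \<open>P k \<le> q\<close> bounds it. Only
  \<open>P (units_sold h) \<le> q\<close> is assumed, not equality, because removing the last buyer
  may lower the current price.\<close>

lemma posted_price_excess:
  fixes P :: "nat \<Rightarrow> real"
  assumes P: "mono P" and "set vs \<subseteq> {..P k}"
  defines "h \<equiv> run k (\<lambda>h. P (units_sold h)) [] vs"
  assumes "P (units_sold h) \<le> q"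
  shows "(\<Sum>v\<leftarrow>vs. max (v - q) 0) + (\<Sum>i<units_sold h. P i) \<le> hist_welfare h"
  using assms(2,4) unfolding h_def
proof (induction vs rule: rev_induct)
  case (snoc v vs)
  let ?h = "run k (\<lambda>h. P (units_sold h)) [] vs"
  have le: "units_sold ?h \<le> k" by (rule units_sold_run_le) simp
  show ?case
  proof (cases "units_sold ?h < k \<and> P (units_sold ?h) \<le> v")
    case True
    then have "P (Suc (units_sold ?h)) \<le> q" using snoc.prems by (simp add: run_append)
    then have q: "P (units_sold ?h) \<le> q"
      using monoD[OF P, of "units_sold ?h" "Suc (units_sold ?h)"] by simp
    then have excess: "max (v - q) 0 \<le> v - P (units_sold ?h)" using True by simp
    have "(\<Sum>v\<leftarrow>vs. max (v - q) 0) + (\<Sum>i<units_sold ?h. P i) \<le> hist_welfare ?h"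
      using snoc q by simp
    from add_mono[OF this excess] True show ?thesis by (simp add: run_append algebra_simps)
  next
    case False
    then have q: "P (units_sold ?h) \<le> q" using snoc.prems by (auto simp: run_append)
    then have "v \<le> q" using False le snoc.prems(1) by (cases "units_sold ?h = k") auto
    then show ?thesis using snoc False q by (auto simp: run_append)
  qed
qed simp

text \<open>By monotonicity a final price of \<open>P 0\<close> means that the price never rose, so
  no buyer was refused while units remained.\<close>

lemma posted_price_all_sold:
  fixes P :: "nat \<Rightarrow> real" and k :: nat
  assumes P: "mono P" and "set vs \<subseteq> {P 0..}"
  defines "h \<equiv> run k (\<lambda>h. P (units_sold h)) [] vs"
  assumes "P (units_sold h) = P 0" "units_sold h < k"
  shows "hist_welfare h = sum_list vs"
  using assms(2,4-) unfolding h_def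
proof (induction vs rule: rev_induct)
  case (snoc v vs)
  let ?h = "run k (\<lambda>h. P (units_sold h)) [] vs"
  have "units_sold ?h \<le> units_sold (run k (\<lambda>h. P (units_sold h)) [] (vs @ [v]))"
    by (simp add: run_append)
  then have "P (units_sold ?h) \<le> P 0" and lt: "units_sold ?h < k"
    using snoc.prems(2,3) monoD[OF P] by (metis, metis le_less_trans)
  moreover have "P 0 \<le> P (units_sold ?h)" using P by (simp add: monoD)
  ultimately have "P (units_sold ?h) = P 0" by simp
  moreover from this have "hist_welfare ?h = sum_list vs" using snoc lt by simp
  ultimately show ?case using snoc.prems(1) lt by (simp add: run_append)
qed simp

text \<open>Let \<open>q\<close> be the price after the last sale. If \<open>q\<close> is
  \<open>\<alpha> / k\<close> times the sum of the prices paid, then \<open>k * q\<close> is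
  \<open>\<alpha>\<close> times that sum, and \<open>opt_le_threshold\<close> meets
  \<open>posted_price_excess\<close>. Otherwise the price is still \<open>L\<close> and every buyer
  got a unit.\<close>

lemma opt_le_ratio_times_welfare:
  assumes "1 \<le> k" "0 < L" "L \<le> U" "1 \<le> \<alpha>" and vs: "set vs \<subseteq> {L..U}"
    and U: "\<alpha> / real k * price_sum L (\<alpha> / real k) k = U"
  shows "opt k vs \<le> \<alpha> * welfare k (\<lambda>h. price L (\<alpha> / real k) (units_sold h)) vs"
proof -
  let ?P = "price L (\<alpha> / real k)"
  define h where "h = run k (\<lambda>h. ?P (units_sold h)) [] vs"
  let ?s = "units_sold h" and ?S = "price_sum L (\<alpha> / real k)"
  have P: "mono ?P" using assms by (intro price_mono) auto
  have [simp]: "?P 0 = L" using \<open>0 < L\<close> by (simp add: price_def)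
  have Pk: "?P k = U" unfolding price_def U using \<open>L \<le> U\<close> by simp
  have "?s \<le> k" unfolding h_def by (rule units_sold_run_le) simp
  have nonneg: "set vs \<subseteq> {0..}" using vs assms by auto
  have "opt k vs \<le> \<alpha> * hist_welfare h"
  proof (cases "L \<le> \<alpha> / real k * ?S ?s")
    case True
    then have eq: "real k * ?P ?s = \<alpha> * ?S ?s" using assms by (simp add: price_def)
    have ex: "(\<Sum>v\<leftarrow>vs. max (v - ?P ?s) 0) + ?S ?s \<le> hist_welfare h"
      unfolding h_def price_sum_eq_sum
      using vs P Pk by (intro posted_price_excess) auto
    let ?e = "\<Sum>v\<leftarrow>vs. max (v - ?P ?s) 0"
    have "opt k vs \<le> \<alpha> * ?S ?s + 1 * ?e"
      using opt_le_threshold[of "?P ?s" k vs] price_ge[of L "\<alpha> / real k" ?s] eq assms by simp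
    also have "\<dots> \<le> \<alpha> * ?S ?s + \<alpha> * ?e"
      using assms by (intro add_left_mono mult_right_mono sum_list_nonneg) auto
    also have "\<dots> \<le> \<alpha> * hist_welfare h"
      unfolding distrib_left[symmetric] using ex assms by (intro mult_left_mono) auto
    finally show ?thesis .
  next
    case False
    \<comment> \<open>After \<open>k\<close> sales the proportional term is \<open>U\<close>, which
      is at least \<open>L\<close>.\<close>
    then have "?s \<noteq> k" using U \<open>L \<le> U\<close> by auto
    with \<open>?s \<le> k\<close> have "?s < k" by simp
    moreover have "?P ?s = ?P 0" using False assms by (simp add: price_def)
    ultimately have "hist_welfare h = sum_list vs"
      unfolding h_def using vs P by (intro posted_price_all_sold) auto
    moreover have "1 * sum_list vs \<le> \<alpha> * sum_list vs"
      using nonneg assms by (intro mult_right_mono sum_list_nonneg) auto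
    ultimately show ?thesis using opt_le_sum_list[OF nonneg, of k] by simp
  qed
  then show ?thesis by (simp add: welfare_eq h_def)
qed

text \<open>First half of the worst case: values equal to the current prices are accepted, so every
  unit is sold without surplus.\<close>

lemma run_exact_prices:
  fixes P :: "nat \<Rightarrow> real"
  assumes "n \<le> k"
  shows "run k (\<lambda>h. P (units_sold h)) [] (map P [0..<n]) = map (\<lambda>i. (P i, True)) [0..<n]"
  using assms
proof (induction n)
  case (Suc n)
  have "units_sold (map (\<lambda>i. (P i, True)) [0..<n]) = n" by (simp add: units_sold_def o_def)
  with Suc show ?case by (simp add: run_append)
qed simp

lemma run_sold_out: "k \<le> units_sold h \<Longrightarrow> run k p h vs = h @ map (\<lambda>v. (v, False)) vs"
  by (induction vs arbitrary: h) auto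

text \<open>The seed law \<open>M\<close> is left general to cover both the uniform seed of
  \<open>cPPM\<close> and a point mass on sequences.\<close>

lemma CVaR_CR_price:
  assumes "prob_space M" "0 < \<delta>" "\<delta> \<le> 1" "1 \<le> k" "0 < L" "L \<le> U" "1 \<le> \<alpha>"
    and U: "\<alpha> / real k * price_sum L (\<alpha> / real k) k = U"
  shows "CVaR_CR \<delta> L U k M (\<lambda>_ h. price L (\<alpha> / real k) (units_sold h)) = ereal \<alpha>"
proof -
  let ?P = "price L (\<alpha> / real k)"
  let ?W = "welfare k (\<lambda>h. ?P (units_sold h))"
  have P: "mono ?P" using assms by (intro price_mono) auto
  have Pk: "?P k = U" unfolding price_def U using \<open>L \<le> U\<close> by simp
  have CR: "CVaR_CR \<delta> L U k M (\<lambda>_ h. ?P (units_sold h))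
      = (SUP vs\<in>instances L U. ereal (opt k vs) / ereal (?W vs))"
    unfolding CVaR_CR_def using assms by (simp add: CVaR_const)
  show ?thesis unfolding CR
  proof (rule antisym)
    show "(SUP vs\<in>instances L U. ereal (opt k vs) / ereal (?W vs)) \<le> ereal \<alpha>"
    proof (rule SUP_least)
      fix vs assume "vs \<in> instances L U"
      then have vs: "vs \<noteq> []" "set vs \<subseteq> {L..U}" by (auto simp: instances_def)
      have le: "opt k vs \<le> \<alpha> * ?W vs"
        using assms vs by (intro opt_le_ratio_times_welfare) auto
      \<comment> \<open>A positive optimum forces positive welfare, so the extended quotient is an
        ordinary one.\<close>
      have "rev (sort vs) \<noteq> []" using vs by (metis length_0_conv length_rev length_sort)
      then have "take k (rev (sort vs)) \<noteq> []" using assms by simp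
      moreover have "\<forall>v\<in>set (take k (rev (sort vs))). 0 < v"
        using vs assms by (fastforce dest: in_set_takeD)
      ultimately have "0 < opt k vs"
        unfolding opt_def by (cases "take k (rev (sort vs))")
          (auto intro!: add_pos_nonneg sum_list_nonneg intro: less_imp_le)
      with le have "0 < \<alpha> * ?W vs" by linarith
      then have "0 < ?W vs" using assms by (simp add: zero_less_mult_iff)
      with le show "ereal (opt k vs) / ereal (?W vs) \<le> ereal \<alpha>" by (simp add: field_simps)
    qed
    \<comment> \<open>The worst case: the units go at exactly their prices, then \<open>k\<close>
      buyers of value \<open>U\<close> find nothing left. The choice of \<open>\<alpha>\<close>
      makes the quotient equal to \<open>\<alpha>\<close>.\<close>
    let ?vs = "map ?P [0..<k] @ replicate k U"
    have "?P i \<le> U" if "i < k" for i using monoD[OF P, of i k] that Pk by simp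
    then have "?vs \<in> instances L U"
      using assms price_ge by (auto simp: instances_def)
    then have "ereal (opt k ?vs) / ereal (?W ?vs)
        \<le> (SUP vs\<in>instances L U. ereal (opt k vs) / ereal (?W vs))"
      by (intro SUP_upper)
    moreover have "opt k ?vs = real k * U"
    proof (rule opt_append_replicate)
      show "sorted ?vs"
        using \<open>\<And>i. i < k \<Longrightarrow> ?P i \<le> U\<close> P
        by (auto simp: sorted_append sorted_map intro!: sorted_wrt_mono_rel[OF _ sorted_upt] monoD[OF P])
    qed
    moreover have "?W ?vs = price_sum L (\<alpha> / real k) k"
    proof -
      have "units_sold (map (\<lambda>i. (?P i, True)) [0..<k]) = k" by (simp add: units_sold_def o_def)
      then show ?thesis
        by (simp add: welfare_def run_append run_exact_prices run_sold_out o_def sum_list_replicate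
            price_sum_eq_sum interv_sum_list_conv_sum_set_nat atLeast0LessThan)
    qed
    moreover have "0 < price_sum L (\<alpha> / real k) k"
      using price_sum_ge[of k L "\<alpha> / real k"] assms
      by (meson less_le_trans mult_pos_pos of_nat_0_less_iff zero_less_one)
    moreover from this have "real k * U / price_sum L (\<alpha> / real k) k = \<alpha>"
      using U assms by (simp add: field_simps)
    ultimately show "ereal \<alpha> \<le> (SUP vs\<in>instances L U. ereal (opt k vs) / ereal (?W vs))"
      by simp
  qed
qed

text \<open>Seeds in \<open>online_algs\<close> are sequences while that of \<open>cPPM\<close> is a
  real, so the rule is realised with a point mass. Together with the logarithmic lower bound this
  makes the optimum finite, so its difference to \<open>\<alpha>\<close> is a real number.\<close>

lemma optimal_CVaR_CR_le_price:
  assumes "0 < \<delta>" "\<delta> \<le> 1" "1 \<le> k" "0 < L" "L \<le> U" "1 \<le> \<alpha>"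
    and U: "\<alpha> / real k * price_sum L (\<alpha> / real k) k = U"
  shows "optimal_CVaR_CR \<delta> L U k \<le> ereal \<alpha>"
proof -
  let ?M = "return borel (\<lambda>_. 0) :: (nat \<Rightarrow> real) measure"
  have M: "prob_space ?M" by (intro prob_space_return) simp
  have "optimal_CVaR_CR \<delta> L U k
      \<le> CVaR_CR \<delta> L U k ?M (\<lambda>_ h. price L (\<alpha> / real k) (units_sold h))"
    unfolding optimal_CVaR_CR_def
    by (rule INF_lower2[of "(?M, \<lambda>_ h. price L (\<alpha> / real k) (units_sold h))"])
      (auto simp: online_algs_def M)
  also have "\<dots> = ereal \<alpha>" using M assms by (intro CVaR_CR_price) auto
  finally show ?thesis .
qed

section \<open>The constant design and its asymptotic optimality\<close>

theorem theorem4: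
  fixes L U \<delta> :: real
  assumes "0 < L" and "L \<le> U" and "0 < \<delta>" and "\<delta> < 1"
  shows "\<exists>\<phi> :: nat \<Rightarrow> nat \<Rightarrow> real \<Rightarrow> real.
    (\<forall>k\<ge>1. pricing_design k (\<phi> k) \<and>
      (\<exists>\<alpha>::real. \<alpha> \<ge> 1 \<and>
        (\<forall>\<beta>::real. \<beta> = real k * U * \<delta> / (\<Sum>i=1..k. integral {0..\<delta>} (\<phi> k i)) \<longleftrightarrow> \<beta> = \<alpha>) \<and>
        cPPM_CVaR_CR \<delta> L U k (\<phi> k) = ereal \<alpha>)) \<and>
    (\<lambda>k. cPPM_CVaR_CR \<delta> L U k (\<phi> k) - optimal_CVaR_CR \<delta> L U k) \<longlonglongrightarrow> 0"
proof -
  have "\<forall>k\<in>{1..}. \<exists>\<alpha>\<ge>1. \<alpha> \<le> U / L \<and> \<alpha> / real k * price_sum L (\<alpha> / real k) k = U"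
    using exists_ratio assms by auto
  then obtain \<alpha> where \<alpha>: "\<And>k. 1 \<le> k \<Longrightarrow> 1 \<le> \<alpha> k" "\<And>k. 1 \<le> k \<Longrightarrow> \<alpha> k \<le> U / L"
    "\<And>k. 1 \<le> k \<Longrightarrow> \<alpha> k / real k * price_sum L (\<alpha> k / real k) k = U"
    by (auto dest!: bchoice)
  define P where "P k = price L (\<alpha> k / real k)" for k
  \<comment> \<open>Level \<open>i\<close> is posted after \<open>i - 1\<close> sales; levels count
    from 1, prices from 0.\<close>
  define \<phi> :: "nat \<Rightarrow> nat \<Rightarrow> real \<Rightarrow> real" where "\<phi> k i = (\<lambda>_. P k (i - 1))" for k i
  have design: "pricing_design k (\<phi> k)" if "1 \<le> k" for k
  proof -
    have "mono (P k)"
      unfolding P_def using assms \<alpha>(1)[OF that] by (intro price_mono) auto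
    then show ?thesis by (auto simp: pricing_design_def \<phi>_def mono_on_def intro: monoD)
  qed
  \<comment> \<open>The factor \<open>\<delta>\<close> from integrating constants cancels, leaving
    the equation that defines \<open>\<alpha> k\<close>. The right-hand side does not involve
    \<open>\<beta>\<close>, which gives uniqueness.\<close>
  have ratio: "real k * U * \<delta> / (\<Sum>i=1..k. integral {0..\<delta>} (\<phi> k i)) = \<alpha> k" if "1 \<le> k" for k
  proof -
    have "(\<Sum>i=1..k. integral {0..\<delta>} (\<phi> k i)) = (\<Sum>i=1..k. \<delta> * P k (i - 1))"
      using assms by (simp add: \<phi>_def)
    also have "\<dots> = \<delta> * price_sum L (\<alpha> k / real k) k"
      unfolding P_def price_sum_eq_sum sum_distrib_left
      by (rule sum.reindex_bij_witness[of _ Suc "\<lambda>i. i - 1"]) auto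
    finally have eq: "(\<Sum>i=1..k. integral {0..\<delta>} (\<phi> k i)) = \<delta> * price_sum L (\<alpha> k / real k) k" .
    have "0 < U" using assms by simp
    then have "price_sum L (\<alpha> k / real k) k \<noteq> 0" using \<alpha>(3)[OF that] by auto
    then show ?thesis using \<alpha>(3)[OF that] assms that unfolding eq by (simp add: field_simps)
  qed
  have unif: "prob_space (restrict_space lborel {0..1::real})"
    by (intro prob_spaceI) (simp add: emeasure_restrict_space space_restrict_space)
  have CR: "cPPM_CVaR_CR \<delta> L U k (\<phi> k) = ereal (\<alpha> k)" if "1 \<le> k" for k
  proof -
    have "cPPM (\<phi> k) = (\<lambda>_ h. price L (\<alpha> k / real k) (units_sold h))"
      by (simp add: fun_eq_iff cPPM_def \<phi>_def P_def)
    then show ?thesis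
      unfolding cPPM_CVaR_CR_def using assms that \<alpha>[OF that] unif by (simp add: CVaR_CR_price)
  qed
  have bounds: "ereal (1 + ln (U / L)) \<le> optimal_CVaR_CR \<delta> L U k"
    "optimal_CVaR_CR \<delta> L U k \<le> ereal (\<alpha> k)" if "1 \<le> k" for k
    using assms that \<alpha>[OF that]
    by (auto intro!: optimal_CVaR_CR_ge_ln optimal_CVaR_CR_le_price)
  let ?g = "\<lambda>k. cPPM_CVaR_CR \<delta> L U k (\<phi> k) - optimal_CVaR_CR \<delta> L U k"
  have "?g \<longlonglongrightarrow> 0"
  \<comment> \<open>The optimum lies between \<open>1 + ln (U / L)\<close> and
    \<open>\<alpha> k\<close>, and these differ by at most a constant over \<open>k\<close>.\<close>
  proof (rule tendsto_sandwich)
    have ev: "\<forall>\<^sub>F k in sequentially. 1 \<le> (k::nat)" by (rule eventually_ge_at_top)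
    show "\<forall>\<^sub>F k in sequentially. 0 \<le> ?g k"
      using ev
    proof eventually_elim
      case (elim k)
      with bounds[OF elim] CR[OF elim] show ?case
        by (cases "optimal_CVaR_CR \<delta> L U k") auto
    qed
    show "\<forall>\<^sub>F k in sequentially. ?g k \<le> ereal (U / L * (1 + ln (U / L)) / real k)"
      using ev
    proof eventually_elim
      case (elim k)
      have "\<alpha> k \<le> 1 + ln (U / L) + U / L * (1 + ln (U / L)) / real k"
        using assms elim \<alpha>[OF elim] by (intro ratio_upper_bound) auto
      with bounds[OF elim] CR[OF elim] show ?case
        by (cases "optimal_CVaR_CR \<delta> L U k") auto
    qed
    have "(\<lambda>k. U / L * (1 + ln (U / L)) / real k) \<longlonglongrightarrow> 0" by real_asymp
    then show "(\<lambda>k. ereal (U / L * (1 + ln (U / L)) / real k)) \<longlonglongrightarrow> 0"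
      unfolding zero_ereal_def by (rule tendsto_ereal)
  qed simp
  with design ratio CR \<alpha>(1) show ?thesis by (intro exI[of _ \<phi>]) auto
qed

end
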